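(* For all complex numbers $a_0,a_1,a_2,a_3$ with $|a_0|=|a_1|=|a_2|=|a_3|=1$, the set $D(a_0,a_1,a_2,a_3)\subset S^3$ is a $24$-point spherical $5$-design. Moreover, these designs form a three-dimensional family, in the following sense: for every $\alpha\in\mathbb{C}$ with $|\alpha|=1$ one has $D(\alpha a_0,\alpha a_1,\alpha a_2,\alpha a_3)\cong D(a_0,a_1,a_2,a_3)$ (so one may normalize $a_0=1$), and for each triple $(a_1,a_2,a_3)$ of complex numbers of absolute value $1$ there are only finitely many triples $(a_1',a_2',a_3')$ of complex numbers of absolute value $1$ such that $D(1,a_1,a_2,a_3)\cong D(1,a_1',a_2',a_3')$.
   Context: Identify $\mathbb{R}^4$ with $\mathbb{C}^2$, with inner product $\langle(z_1,z_2),(\zeta_1,\zeta_2)\rangle=\operatorname{Re}(z_1\overline{\zeta_1}+z_2\overline{\zeta_2})$, and let $S^3$ be the unit sphere. Let $\mu_6\subset\mathbb{C}^*$ be the group of sixth roots of unity, $r=e^{2\pi i/3}$, $u=\sqrt{1/3}$, $t=\sqrt{2/3}$, and define \begin{align*} H_0&=\{(w,0):w\in\mu_6\},\\ H_1&=\{(uiw,tiw):w\in\mu_6\},\\ H_2&=\{(uiw,rtiw):w\in\mu_6\},\\ H_3&=\{(uiw,\overline{r}tiw):w\in\mu_6\}. \end{align*} For complex numbers $a_0,a_1,a_2,a_3$ of absolute value $1$, define $$D(a_0,a_1,a_2,a_3)=a_0H_0\cup a_1H_1\cup a_2H_2\cup a_3H_3,$$ where $a_m H_m=\{(a_mz_1,a_mz_2):(z_1,z_2)\in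 H_m\}$. (The set $D(1,1,1,1)$ is a copy of $C_{D_4}$, the set of vertices of the regular $24$-cell.) A finite set $C\subset S^3$ is a spherical $5$-design if for every real polynomial $P$ of degree at most $5$ on $\mathbb{R}^4$, the average of $P$ over $C$ equals the average of $P$ over $S^3$ (with respect to the rotation-invariant probability measure). For subsets $C,C'\subset S^3$, $C\cong C'$ means that some orthogonal transformation of $\mathbb{R}^4$ maps $C$ onto $C'$. *)

theory Defs
  imports "HOL-Probability.Probability"
begin

definition polynomial_deg_le :: "nat \<Rightarrow> ('a::euclidean_space \<Rightarrow> real) \<Rightarrow> bool" where
  "polynomial_deg_le n P \<longleftrightarrow>
     (\<exists>(K :: ('a \<Rightarrow> nat) set) c.
        finite K \<and> (\<forall>k\<in>K. (\<Sum>b\<in>Basis. k b) \<le> n) \<and>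
        P = (\<lambda>x. \<Sum>k\<in>K. c k * (\<Prod>b\<in>Basis. (x \<bullet> b) ^ k b)))"

text \<open>
  The rotation-invariant probability measure on the unit sphere, regarded as a measure on the
  ambient space: the radial projection of the uniform distribution on the unit ball. The lemmas
  below verify that it is a probability measure, carried by the sphere and invariant under all
  orthogonal transformations (the last of these on the space that is used here).
\<close>

definition sphere_measure :: "'a::euclidean_space measure" where
  "sphere_measure = distr (uniform_measure lborel (ball 0 1)) borel (\<lambda>x. x /\<^sub>R norm x)"

lemma emeasure_unit_ball:
  "emeasure lborel (ball (0::'a::euclidean_space) 1) \<noteq> 0"
  "emeasure lborel (ball (0::'a::euclidean_space) 1) \<noteq> \<infinity>"
  using unit_ball_vol_pos[of "real DIM('a)"] by (auto simp: emeasure_ball simp del: unit_ball_vol_pos)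

lemma prob_space_sphere_measure: "prob_space (sphere_measure :: 'a::euclidean_space measure)"
  unfolding sphere_measure_def
  by (intro prob_space.prob_space_distr prob_space_uniform_measure emeasure_unit_ball) simp

lemma AE_sphere_measure: "AE x in (sphere_measure :: 'a::euclidean_space measure). x \<in> sphere 0 1"
proof -
  have "AE x in lborel. x \<noteq> (0::'a)"
    by (rule AE_lborel_singleton)
  then have "AE x in lborel. x \<in> ball (0::'a) 1 \<longrightarrow> x /\<^sub>R norm x \<in> sphere 0 1"
    by eventually_elim simp
  then have "AE x in uniform_measure lborel (ball (0::'a) 1). x /\<^sub>R norm x \<in> sphere 0 1"
    by (intro AE_uniform_measureI) auto
  then show ?thesis
    unfolding sphere_measure_def by (subst AE_distr_iff) simp_all
qed

lemma lborel_orthogonal_cart: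
  fixes f :: "real ^ 'n::{finite,wellorder} \<Rightarrow> real ^ 'n::_"
  assumes f: "orthogonal_transformation f"
  shows "distr lborel borel f = lborel"
proof (rule sym, rule lborel_eqI)
  fix l u :: "real ^ 'n::{finite,wellorder}" assume lu: "\<And>b. b \<in> Basis \<Longrightarrow> l \<bullet> b \<le> u \<bullet> b"
  have [measurable]: "f \<in> borel_measurable borel"
    using orthogonal_transformation_linear[OF f]
    by (auto intro!: borel_measurable_continuous_onI linear_continuous_on
        simp: linear_conv_bounded_linear)
  have inv: "orthogonal_transformation (inv f)"
    using f by (rule orthogonal_transformation_inv)
  have vim: "f -` box l u = inv f ` box l u"
    using f by (intro bij_vimage_eq_inv_image orthogonal_transformation_bij)
  have lm: "box l u \<in> lmeasurable" by simp
  have "emeasure (distr lborel borel f) (box l u) = emeasure lborel (inv f ` box l u)"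
    by (subst emeasure_distr) (simp_all add: vim)
  also have "inv f ` box l u \<in> sets borel"
    using measurable_sets[of f borel borel "box l u"] by (simp add: vim)
  then have "emeasure lborel (inv f ` box l u) = emeasure lebesgue (inv f ` box l u)"
    by simp
  also have "\<dots> = measure lebesgue (box l u)"
    using measurable_orthogonal_image[OF inv lm] measure_orthogonal_image[OF inv lm]
    by (simp add: emeasure_eq_measure2 fmeasurableD2)
  also have "\<dots> = (\<Prod>b\<in>Basis. (u - l) \<bullet> b)"
    using lu by (simp add: measure_lborel_box_eq)
  finally show "emeasure (distr lborel borel f) (box l u) = (\<Prod>b\<in>Basis. (u - l) \<bullet> b)" .
qed simp

lemma lborel_orthogonal_C2:
  fixes f :: "complex \<times> complex \<Rightarrow> complex \<times> complex"
  assumes f: "orthogonal_transformation f"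
  shows "distr lborel borel f = lborel"
proof -
  have "card (Basis :: (complex \<times> complex) set) = card (UNIV :: 4 set)"
    by simp
  then obtain \<beta> :: "4 \<Rightarrow> complex \<times> complex" where \<beta>: "bij_betw \<beta> UNIV Basis"
    by (metis finite_Basis finite bij_betw_iff_card)
  have \<beta>B: "\<beta> i \<in> Basis" for i
    using \<beta> by (auto simp: bij_betw_def)
  have \<beta>\<beta>: "\<beta> i \<bullet> \<beta> j = (if i = j then 1 else 0)" for i j
    using \<beta> inner_Basis[OF \<beta>B \<beta>B] by (auto simp: bij_betw_def inj_eq)
  define \<phi> :: "real ^ 4 \<Rightarrow> complex \<times> complex" where "\<phi> v = (\<Sum>i\<in>UNIV. (v $ i) *\<^sub>R \<beta> i)" for v
  define \<psi> :: "complex \<times> complex \<Rightarrow> real ^ 4" where "\<psi> x = (\<chi> i. x \<bullet> \<beta> i)" for x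
  have inner_\<phi>: "\<phi> v \<bullet> \<beta> i = v $ i" for v i
    by (simp add: \<phi>_def inner_sum_left \<beta>\<beta> if_distrib cong: if_cong)
  have \<psi>\<phi>: "\<psi> (\<phi> v) = v" for v
    by (simp add: \<psi>_def inner_\<phi> vec_eq_iff)
  have \<phi>\<psi>: "\<phi> (\<psi> x) = x" for x
  proof -
    have "\<phi> (\<psi> x) = (\<Sum>b\<in>Basis. (x \<bullet> b) *\<^sub>R b)"
      unfolding \<phi>_def \<psi>_def using \<beta> by (simp add: sum.reindex_bij_betw[of \<beta> UNIV Basis "\<lambda>b. (x \<bullet> b) *\<^sub>R b"])
    then show ?thesis by (simp add: euclidean_representation)
  qed
  have lin_\<phi>: "linear \<phi>"
    by (rule linearI) (simp_all add: \<phi>_def scaleR_left_distrib sum.distrib scaleR_sum_right)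
  have lin_\<psi>: "linear \<psi>"
    by (rule linearI) (simp_all add: \<psi>_def vec_eq_iff inner_left_distrib)
  have \<psi>_inner: "\<psi> x \<bullet> \<psi> y = x \<bullet> y" for x y
  proof -
    have "x \<bullet> y = (\<Sum>b\<in>Basis. (x \<bullet> b) * (y \<bullet> b))"
      by (rule euclidean_inner)
    also have "\<dots> = \<psi> x \<bullet> \<psi> y"
      unfolding \<psi>_def using \<beta>
      by (simp add: inner_vec_def sum.reindex_bij_betw[of \<beta> UNIV Basis "\<lambda>b. (x \<bullet> b) * (y \<bullet> b)"])
    finally show ?thesis by simp
  qed
  have \<phi>_inner: "\<phi> v \<bullet> \<phi> w = v \<bullet> w" for v w
    using \<psi>_inner[of "\<phi> v" "\<phi> w"] by (simp add: \<psi>\<phi>)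
  have [measurable]: "\<phi> \<in> borel_measurable borel" "\<psi> \<in> borel_measurable borel" "f \<in> borel_measurable borel"
    using lin_\<phi> lin_\<psi> orthogonal_transformation_linear[OF f]
    by (auto intro!: borel_measurable_continuous_onI linear_continuous_on
        simp: linear_conv_bounded_linear)
  have lborel_\<phi>: "distr lborel borel \<phi> = lborel"
  proof (rule sym, rule lborel_eqI)
    fix l u :: "complex \<times> complex" assume lu: "\<And>b. b \<in> Basis \<Longrightarrow> l \<bullet> b \<le> u \<bullet> b"
    have Bball: "(\<forall>b\<in>Basis. P b) \<longleftrightarrow> (\<forall>i. P (\<beta> i))" for P
      using \<beta> by (metis bij_betw_def rangeE rangeI)
    have vim: "\<phi> -` box l u = box (\<psi> l) (\<psi> u)"
      by (auto simp: box_def Bball inner_\<phi> \<psi>_def Basis_vec_def inner_axis)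
    have le: "\<forall>b\<in>Basis. \<psi> l \<bullet> b \<le> \<psi> u \<bullet> b"
      using lu \<beta>B by (auto simp: \<psi>_def Basis_vec_def inner_axis)
    have "emeasure (distr lborel borel \<phi>) (box l u) = emeasure lborel (box (\<psi> l) (\<psi> u))"
      by (subst emeasure_distr) (simp_all add: vim)
    also have "\<dots> = (\<Prod>b\<in>Basis. (\<psi> u - \<psi> l) \<bullet> b)"
      using le by (simp add: emeasure_lborel_box_eq)
    also have "(\<Prod>b\<in>Basis. (\<psi> u - \<psi> l) \<bullet> b) = (\<Prod>i\<in>UNIV. (u - l) \<bullet> \<beta> i)"
      by (simp add: Basis_vec_def UNION_singleton_eq_range prod.reindex inj_on_def axis_eq_axis
          inner_axis \<psi>_def inner_diff_left)
    also have "\<dots> = (\<Prod>b\<in>Basis. (u - l) \<bullet> b)"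
      using prod.reindex_bij_betw[OF \<beta>, of "\<lambda>b. (u - l) \<bullet> b"] by simp
    finally show "emeasure (distr lborel borel \<phi>) (box l u) = (\<Prod>b\<in>Basis. (u - l) \<bullet> b)" .
  qed simp
  have orth: "orthogonal_transformation (\<psi> \<circ> f \<circ> \<phi>)"
  proof -
    have "linear (\<psi> \<circ> f \<circ> \<phi>)"
      using linear_compose[OF lin_\<phi> linear_compose[OF orthogonal_transformation_linear[OF f] lin_\<psi>]] .
    moreover have "f x \<bullet> f y = x \<bullet> y" for x y
      using f unfolding orthogonal_transformation_def by blast
    ultimately show ?thesis
      unfolding orthogonal_transformation_def by (simp only: o_apply \<psi>_inner \<phi>_inner simp_thms)
  qed
  have "distr lborel borel f = distr (distr lborel borel \<phi>) borel f"
    by (simp only: lborel_\<phi>)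
  also have "\<dots> = distr lborel borel (f \<circ> \<phi>)"
    by (simp add: distr_distr)
  also have "f \<circ> \<phi> = \<phi> \<circ> (\<psi> \<circ> f \<circ> \<phi>)"
    by (simp add: fun_eq_iff \<phi>\<psi>)
  also have "distr lborel borel \<dots> = distr (distr lborel borel (\<psi> \<circ> f \<circ> \<phi>)) borel \<phi>"
    by (simp add: distr_distr)
  also have "\<dots> = lborel"
    by (simp only: lborel_orthogonal_cart[OF orth] lborel_\<phi>)
  finally show ?thesis .
qed

lemma sphere_measure_orthogonal_invariant:
  fixes f :: "complex \<times> complex \<Rightarrow> complex \<times> complex"
  assumes f: "orthogonal_transformation f"
  shows "distr sphere_measure borel f = sphere_measure"
proof -
  let ?B = "ball (0 :: complex \<times> complex) 1"
  let ?U = "uniform_measure lborel ?B"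
  let ?N = "\<lambda>x :: complex \<times> complex. x /\<^sub>R norm x"
  have lin: "linear f" and nrm: "norm (f x) = norm x" for x
    using f by (simp_all add: orthogonal_transformation_linear orthogonal_transformation_norm)
  have [measurable]: "f \<in> borel_measurable borel"
    using lin by (auto intro!: borel_measurable_continuous_onI linear_continuous_on
        simp: linear_conv_bounded_linear)
  have U: "distr ?U borel f = ?U"
  proof (rule measure_eqI)
    fix A assume "A \<in> sets (distr ?U borel f)"
    then have A [measurable]: "A \<in> sets borel" by simp
    have "f -` A \<in> sets borel"
      using measurable_sets[of f borel borel A] by simp
    then have "emeasure (distr ?U borel f) A = emeasure lborel (?B \<inter> f -` A) / emeasure lborel ?B"
      by (subst emeasure_distr) simp_all
    also have "?B \<inter> f -` A = f -` (?B \<inter> A)"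
      by (simp add: set_eq_iff nrm del: split_paired_All)
    also have "emeasure lborel (f -` (?B \<inter> A)) = emeasure (distr lborel borel f) (?B \<inter> A)"
      by (subst emeasure_distr) simp_all
    also have "\<dots> = emeasure lborel (?B \<inter> A)"
      by (simp only: lborel_orthogonal_C2[OF f])
    finally show "emeasure (distr ?U borel f) A = emeasure ?U A"
      by simp
  qed simp
  have "distr sphere_measure borel f = distr ?U borel (f \<circ> ?N)"
    by (simp add: sphere_measure_def distr_distr)
  also have "f \<circ> ?N = ?N \<circ> f"
    by (simp add: fun_eq_iff nrm linear_scale[OF lin])
  also have "distr ?U borel (?N \<circ> f) = distr (distr ?U borel f) borel ?N"
    by (simp add: distr_distr)
  also have "\<dots> = sphere_measure"
    by (simp only: U sphere_measure_def)
  finally show ?thesis .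
qed

definition spherical_design :: "nat \<Rightarrow> 'a::euclidean_space set \<Rightarrow> bool" where
  "spherical_design n C \<longleftrightarrow>
     finite C \<and> C \<subseteq> sphere 0 1 \<and>
     (\<forall>P. polynomial_deg_le n P \<longrightarrow>
        (\<Sum>x\<in>C. P x) / real (card C) = (\<integral>x. P x \<partial>sphere_measure))"

definition congruent_sets :: "'a::euclidean_space set \<Rightarrow> 'a set \<Rightarrow> bool"  (infix "\<cong>\<^sub>O" 50) where
  "C \<cong>\<^sub>O C' \<longleftrightarrow> (\<exists>f. orthogonal_transformation f \<and> f ` C = C')"

definition mu6 :: "complex set" where
  "mu6 = {w. w ^ 6 = 1}"

definition rD :: complex where "rD = exp (2 * of_real pi * \<i> / 3)"

definition uD :: real where "uD = sqrt (1 / 3)"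

definition tD :: real where "tD = sqrt (2 / 3)"

definition H0 :: "(complex \<times> complex) set" where
  "H0 = {(w, 0) | w. w \<in> mu6}"

definition H1 :: "(complex \<times> complex) set" where
  "H1 = {(of_real uD * \<i> * w, of_real tD * \<i> * w) | w. w \<in> mu6}"

definition H2 :: "(complex \<times> complex) set" where
  "H2 = {(of_real uD * \<i> * w, rD * of_real tD * \<i> * w) | w. w \<in> mu6}"

definition H3 :: "(complex \<times> complex) set" where
  "H3 = {(of_real uD * \<i> * w, cnj rD * of_real tD * \<i> * w) | w. w \<in> mu6}"

definition cscale :: "complex \<Rightarrow> (complex \<times> complex) set \<Rightarrow> (complex \<times> complex) set" where
  "cscale a H = {(a * z1, a * z2) | z1 z2. (z1, z2) \<in> H}"

definition D :: "complex \<Rightarrow> complex \<Rightarrow> complex \<Rightarrow> complex \<Rightarrow> (complex \<times> complex) set" where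
  "D a0 a1 a2 a3 = cscale a0 H0 \<union> cscale a1 H1 \<union> cscale a2 H2 \<union> cscale a3 H3"

end

theory Submission
  imports Defs
begin

text \<open>
  Each of the four pieces of \<open>D a0 a1 a2 a3\<close> is an orbit \<open>{w p | w \<in> mu6}\<close>, that is, a regular
  hexagon on the great circle cut out by a complex line. On a great circle a polynomial of degree
  at most \<open>5\<close> is a trigonometric polynomial of degree at most \<open>5\<close>, so its mean over a hexagon
  is its mean over the whole circle. Rotating each hexagon in its own circle, which is what the
  parameters \<open>a0, ..., a3\<close> do, therefore does not change any mean. The four circles
  correspond under the Hopf map to the vertices of a regular tetrahedron, a \<open>2\<close>-design on the
  \<open>2\<close>-sphere, and means over Hopf circles of polynomials of degree at most \<open>5\<close> are
  polynomials of degree at most \<open>2\<close> in the Hopf image; hence the design property.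

  The proof makes this explicit in the monomials
  \<open>z1^a * cnj z1^b * z2^c * cnj z2^d\<close>, which span all polynomials over the complex numbers
  (\<open>cpoly_of_polynomial_deg_le\<close>). Summation over a hexagon kills those with
  \<open>a + c \<noteq> b + d\<close>, the three cube roots of unity in \<open>H1\<close>, \<open>H2\<close>, \<open>H3\<close> kill those that remain
  with \<open>c \<noteq> d\<close>, and the values of \<open>uD\<close> and \<open>tD\<close> give the others the right mean
  (\<open>sum_zmono_D\<close>). On the sphere the same values are forced by invariance under the torus, the
  coordinate swap and one further unitary rotation (\<open>integral_zmono\<close>).

  For the finiteness, a congruence preserves the set of inner products of pairs of points, and this
  set is finite. The point \<open>(1, 0)\<close> and a point of the hexagon with parameter \<open>b\<close> have inner
  product \<open>- uD * Im b\<close>. So for all sets congruent to a given one, \<open>Im b\<close> takes finitely many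
  values, and each value leaves at most two \<open>b\<close> on the unit circle.
\<close>

section \<open>Polynomials in the complex coordinates and their conjugates\<close>

definition cmul :: "complex \<Rightarrow> complex \<times> complex \<Rightarrow> complex \<times> complex" where
  "cmul w p = (w * fst p, w * snd p)"

definition hexagon :: "complex \<times> complex \<Rightarrow> (complex \<times> complex) set" where
  "hexagon p = (\<lambda>w. cmul w p) ` mu6"

definition zmono :: "nat \<Rightarrow> nat \<Rightarrow> nat \<Rightarrow> nat \<Rightarrow> complex \<times> complex \<Rightarrow> complex" where
  "zmono a b c d z = fst z ^ a * cnj (fst z) ^ b * snd z ^ c * cnj (snd z) ^ d"

inductive cpoly :: "nat \<Rightarrow> (complex \<times> complex \<Rightarrow> complex) \<Rightarrow> bool" for n where
  mono: "a + b + c + d \<le> n \<Longrightarrow> cpoly n (zmono a b c d)"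
| add: "cpoly n f \<Longrightarrow> cpoly n g \<Longrightarrow> cpoly n (\<lambda>z. f z + g z)"
| scale: "cpoly n f \<Longrightarrow> cpoly n (\<lambda>z. s * f z)"

lemma cpoly_weaken:
  assumes "cpoly m f" "m \<le> n" shows "cpoly n f"
  using assms by induction (auto intro: cpoly.intros)

lemma cpoly_mult:
  assumes f: "cpoly m f" and g: "cpoly n g"
  shows "cpoly (m + n) (\<lambda>z. f z * g z)"
  using f
proof induction
  case (mono a b c d)
  note deg = mono
  from g show ?case
  proof induction
    case (mono a' b' c' d')
    have "(\<lambda>z. zmono a b c d z * zmono a' b' c' d' z) = zmono (a+a') (b+b') (c+c') (d+d')"
      by (simp add: zmono_def fun_eq_iff power_add)
    with deg mono show ?case by (auto intro: cpoly.mono)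
  next
    case (add f g)
    then show ?case by (simp add: distrib_left cpoly.add)
  next
    case (scale f s)
    then show ?case using cpoly.scale[OF scale.IH, of s] by (simp add: mult_ac)
  qed
next
  case (add f g)
  then show ?case by (simp add: distrib_right cpoly.add)
next
  case (scale f s)
  then show ?case using cpoly.scale[OF scale.IH, of s] by (simp add: mult_ac)
qed

lemma cpoly_const: "cpoly n (\<lambda>z. s)"
  using cpoly.scale[OF cpoly.mono[of 0 0 0 0 n], of s] by (simp add: zmono_def)

lemma cpoly_power: "cpoly 1 f \<Longrightarrow> cpoly k (\<lambda>z. f z ^ k)"
  by (induction k) (use cpoly_const[of 0 1] cpoly_mult[of 1 f] in auto)

lemma cpoly_prod:
  assumes "finite B" "\<And>b. b \<in> B \<Longrightarrow> cpoly (k b) (f b)"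
  shows "cpoly (\<Sum>b\<in>B. k b) (\<lambda>z. \<Prod>b\<in>B. f b z)"
  using assms by (induction B) (auto simp: cpoly_const intro!: cpoly_mult)

lemma cpoly_sum:
  assumes "finite B" "\<And>b. b \<in> B \<Longrightarrow> cpoly n (f b)"
  shows "cpoly n (\<lambda>z. \<Sum>b\<in>B. f b z)"
  using assms by (induction B) (auto simp: cpoly_const intro!: cpoly.add)

text \<open>
  Real and imaginary parts of \<open>z1\<close> and \<open>z2\<close> are combinations of the coordinates and their
  conjugates; this is why complex coefficients are admitted in \<open>cpoly\<close>.
\<close>
lemma cpoly_coordinate:
  fixes b :: "complex \<times> complex"
  assumes "b \<in> Basis" shows "cpoly 1 (\<lambda>z. of_real (z \<bullet> b))"
proof -
  have z1: "cpoly 1 fst" and z1c: "cpoly 1 (\<lambda>z. cnj (fst z))"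
    and z2: "cpoly 1 snd" and z2c: "cpoly 1 (\<lambda>z. cnj (snd z))"
    using cpoly.mono[of 1 0 0 0 1] cpoly.mono[of 0 1 0 0 1]
      cpoly.mono[of 0 0 1 0 1] cpoly.mono[of 0 0 0 1 1]
    by (simp_all add: zmono_def[abs_def])
  have re: "of_real (Re w) = 1/2 * w + 1/2 * cnj w"
    and im: "of_real (Im w) = -\<i>/2 * w + \<i>/2 * cnj w" for w
    by (simp_all add: complex_eq_iff)
  have "b \<in> {(1,0), (\<i>,0), (0,1), (0,\<i>)}"
    using assms by (auto simp: Basis_prod_def Basis_complex_def)
  then show ?thesis
    by (auto simp only: insert_iff empty_iff inner_prod_def fst_conv snd_conv inner_zero_right
          complex_inner_1_right complex_inner_i_right add_0_left add_0_right re im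
        intro!: cpoly.add cpoly.scale z1 z1c z2 z2c)
qed

lemma cpoly_of_polynomial_deg_le:
  fixes P :: "complex \<times> complex \<Rightarrow> real"
  assumes "polynomial_deg_le n P" shows "cpoly n (\<lambda>z. of_real (P z))"
proof -
  obtain K :: "(complex \<times> complex \<Rightarrow> nat) set" and c where K: "finite K"
    "\<And>k. k \<in> K \<Longrightarrow> (\<Sum>b\<in>Basis. k b) \<le> n"
    and P: "P = (\<lambda>x. \<Sum>k\<in>K. c k * (\<Prod>b\<in>Basis. (x \<bullet> b) ^ k b))"
    using assms unfolding polynomial_deg_le_def by blast
  show ?thesis unfolding P of_real_sum of_real_mult of_real_prod of_real_power
    by (intro cpoly_sum K(1) cpoly.scale cpoly_weaken[OF cpoly_prod K(2)] finite_Basis)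
      (rule cpoly_power, rule cpoly_coordinate)
qed

section \<open>Hexagons\<close>

lemma zmono_scale: "zmono a b c d (cmul w p) = w ^ (a + c) * cnj w ^ (b + d) * zmono a b c d p"
  by (simp add: zmono_def cmul_def power_add power_mult_distrib)

lemma unit_power_cnj: "cmod w = 1 \<Longrightarrow> w ^ k * cnj w ^ k = 1"
  by (simp flip: power_mult_distrib add: complex_norm_square[symmetric])

lemma mu6_norm: "w \<in> mu6 \<Longrightarrow> cmod w = 1"
  using power_eq_imp_eq_norm[of w 6 1] by (simp add: mu6_def)

text \<open>
  The character \<open>z ^ (k - l)\<close> of the sixth roots of unity is nontrivial for
  \<open>0 < \<bar>k - l\<bar> < 6\<close>. This is where degree \<open>5\<close> is the limit, both for the hexagon sums and
  for the torus averages below.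
\<close>
lemma ex_separating_root:
  assumes "k < 6" "l < 6" "k \<noteq> l"
  obtains z where "z \<in> mu6" "z ^ k * cnj z ^ l \<noteq> 1"
proof -
  define z where "z = cis (2 * pi / 6)"
  have pow: "z ^ j = cis (2 * pi * real j / real 6)" for j
  proof -
    have "z ^ j = cis (real j * (2 * pi / 6))" unfolding z_def by (rule Complex.DeMoivre)
    also have "real j * (2 * pi / 6) = 2 * pi * real j / real 6" by simp
    finally show ?thesis .
  qed
  from pow[of 6] have z6: "z ^ 6 = 1" by simp
  note pow
  moreover have "inj_on (\<lambda>k. cis (2 * pi * real k / real 6)) {..<6}"
    using Complex.bij_betw_roots_unity[of 6] by (simp add: bij_betw_def)
  ultimately have ne: "z ^ k \<noteq> z ^ l"
    using assms by (auto simp: inj_on_def)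
  have unit: "cmod z = 1" by (simp add: z_def)
  have "z ^ k * cnj z ^ l \<noteq> 1"
  proof
    assume "z ^ k * cnj z ^ l = 1"
    then have "z ^ k * (z ^ l * cnj z ^ l) = z ^ l" by (simp add: mult.left_commute)
    then show False using ne unit_power_cnj[of z l] unit by simp
  qed
  with z6 show ?thesis using that[of z] by (simp add: mu6_def)
qed

lemma finite_mu6: "finite mu6" and card_mu6: "card mu6 = 6"
  using finite_nth_roots[of 6 1] card_nth_roots[of 1 6] by (simp_all add: mu6_def)

lemma sum_mu6:
  assumes "k < 6" "l < 6"
  shows "(\<Sum>w\<in>mu6. w ^ k * cnj w ^ l) = (if k = l then 6 else 0)"
proof (cases "k = l")
  case True
  have "(\<Sum>w\<in>mu6. w ^ k * cnj w ^ l) = (\<Sum>w\<in>mu6. 1)"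
    by (rule sum.cong) (simp_all add: True unit_power_cnj mu6_norm)
  then show ?thesis using True by (simp add: card_mu6)
next
  case False
  then obtain z where z: "z \<in> mu6" "z ^ k * cnj z ^ l \<noteq> 1"
    using ex_separating_root assms by blast
  have [simp]: "z \<noteq> 0" using mu6_norm[OF z(1)] by auto
  have bij: "bij_betw ((*) z) mu6 mu6"
    using z(1) by (intro bij_betwI[where g = "\<lambda>w. w / z"]) (auto simp: mu6_def power_mult_distrib power_divide)
  let ?S = "\<Sum>w\<in>mu6. w ^ k * cnj w ^ l"
  have "?S = (\<Sum>w\<in>mu6. (z * w) ^ k * cnj (z * w) ^ l)"
    by (rule sum.reindex_bij_betw[OF bij, symmetric])
  also have "\<dots> = z ^ k * cnj z ^ l * ?S"
    by (simp add: sum_distrib_left power_mult_distrib mult_ac)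
  finally show ?thesis using z(2) False by simp
qed

lemma inj_cmul: "p \<noteq> 0 \<Longrightarrow> inj (\<lambda>w. cmul w p)"
  by (cases p) (auto simp: inj_def cmul_def zero_prod_def)

lemma card_hexagon: "p \<noteq> 0 \<Longrightarrow> card (hexagon p) = 6"
  unfolding hexagon_def by (simp add: card_image inj_on_subset[OF inj_cmul] card_mu6)

lemma finite_hexagon: "finite (hexagon p)"
  by (simp add: hexagon_def finite_mu6)

text \<open>
  The determinant condition says that the hexagons lie in different complex lines, which meet only
  in the origin.
\<close>
lemma hexagon_disjoint:
  assumes "fst p * snd q \<noteq> snd p * fst q"
  shows "hexagon p \<inter> hexagon q = {}"
proof -
  have False if w: "w \<in> mu6" and v: "v \<in> mu6" and eq: "cmul w p = cmul v q" for w v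
  proof -
    have e: "w * fst p = v * fst q" "w * snd p = v * snd q"
      using eq by (simp_all add: cmul_def)
    have "(w * fst p) * (v * snd q) = (v * fst q) * (w * snd p)"
      by (simp only: e)
    then have "w * v * (fst p * snd q) = w * v * (snd p * fst q)"
      by (simp only: mult_ac)
    moreover have "w \<noteq> 0" "v \<noteq> 0" using mu6_norm[OF w] mu6_norm[OF v] by auto
    ultimately show False using assms by simp
  qed
  then show ?thesis unfolding hexagon_def by blast
qed

lemma sum_hexagon:
  assumes deg: "a + b + c + d \<le> 5" and p: "p \<noteq> 0"
  shows "(\<Sum>x\<in>hexagon p. zmono a b c d x) = (if a + c = b + d then 6 * zmono a b c d p else 0)"
proof -
  have "(\<Sum>x\<in>hexagon p. zmono a b c d x) = (\<Sum>w\<in>mu6. zmono a b c d (cmul w p))"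
    unfolding hexagon_def by (subst sum.reindex) (simp_all add: inj_on_subset[OF inj_cmul[OF p]])
  also have "\<dots> = (\<Sum>w\<in>mu6. w ^ (a + c) * cnj w ^ (b + d)) * zmono a b c d p"
    by (simp add: zmono_scale sum_distrib_right)
  finally show ?thesis using deg by (simp add: sum_mu6)
qed

lemma norm_cmul: "norm (cmul w p) = cmod w * norm p"
  by (simp add: cmul_def norm_prod_def norm_mult power_mult_distrib flip: distrib_left)
    (simp add: real_sqrt_mult)

section \<open>The sums of monomials over the 24 points\<close>

lemma D_eq:
  "D a0 a1 a2 a3 =
     hexagon (cmul a0 (1, 0)) \<union> hexagon (cmul a1 (uD * \<i>, tD * \<i>)) \<union>
     hexagon (cmul a2 (uD * \<i>, tD * \<i> * rD)) \<union> hexagon (cmul a3 (uD * \<i>, tD * \<i> * cnj rD))"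
proof -
  have 0: "cscale a0 H0 = hexagon (cmul a0 (1, 0))"
    by (auto simp: cscale_def H0_def hexagon_def cmul_def image_def mult_ac)
  have 1: "cscale a1 H1 = hexagon (cmul a1 (uD * \<i>, tD * \<i>))"
    by (force simp: cscale_def H1_def hexagon_def cmul_def image_def mult_ac)
  have 2: "cscale a2 H2 = hexagon (cmul a2 (uD * \<i>, tD * \<i> * rD))"
    by (force simp: cscale_def H2_def hexagon_def cmul_def image_def mult_ac)
  have 3: "cscale a3 H3 = hexagon (cmul a3 (uD * \<i>, tD * \<i> * cnj rD))"
    by (force simp: cscale_def H3_def hexagon_def cmul_def image_def mult_ac)
  show ?thesis unfolding D_def 0 1 2 3 by simp
qed

lemma rD_eq: "rD = Complex (- 1 / 2) (sqrt 3 / 2)"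
proof -
  have "rD = cis (2 * pi / 3)" unfolding rD_def by (simp add: cis_conv_exp mult_ac)
  then show ?thesis by (simp add: cis.ctr cos_120 sin_120)
qed

lemma rD_facts: "rD \<noteq> 1" "cnj rD \<noteq> 1" "rD \<noteq> cnj rD" "cmod rD = 1"
  by (auto simp: rD_eq complex_eq_iff cmod_def power_divide)

lemma uD_tD: "uD \<noteq> 0" "tD \<noteq> 0" "uD\<^sup>2 = 1 / 3" "tD\<^sup>2 = 2 / 3"
  by (simp_all add: uD_def tD_def)

lemma
  assumes "cmod a0 = 1" "cmod a1 = 1" "cmod a2 = 1" "cmod a3 = 1"
  shows D_subset_sphere: "D a0 a1 a2 a3 \<subseteq> sphere 0 1"
    and card_D: "card (D a0 a1 a2 a3) = 24"
    and sum_D_hexagons: "(\<Sum>x\<in>D a0 a1 a2 a3. f x :: complex) =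
       (\<Sum>x\<in>hexagon (cmul a0 (1, 0)). f x) + (\<Sum>x\<in>hexagon (cmul a1 (uD * \<i>, tD * \<i>)). f x) +
       (\<Sum>x\<in>hexagon (cmul a2 (uD * \<i>, tD * \<i> * rD)). f x) +
       (\<Sum>x\<in>hexagon (cmul a3 (uD * \<i>, tD * \<i> * cnj rD)). f x)"
proof -
  have nz: "a0 \<noteq> 0" "a1 \<noteq> 0" "a2 \<noteq> 0" "a3 \<noteq> 0" using assms by auto
  let ?A = "hexagon (cmul a0 (1, 0))" and ?B = "hexagon (cmul a1 (uD * \<i>, tD * \<i>))"
  let ?C = "hexagon (cmul a2 (uD * \<i>, tD * \<i> * rD))"
  let ?E = "hexagon (cmul a3 (uD * \<i>, tD * \<i> * cnj rD))"
  have r0: "rD \<noteq> 0" using rD_facts(4) by auto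
  have disj: "?A \<inter> ?B = {}" "(?A \<union> ?B) \<inter> ?C = {}" "(?A \<union> ?B \<union> ?C) \<inter> ?E = {}"
    using nz uD_tD(1,2) rD_facts(1-3) r0
    by (auto simp: Int_Un_distrib2 intro!: hexagon_disjoint simp: cmul_def)
  have card: "card ?A = 6" "card ?B = 6" "card ?C = 6" "card ?E = 6"
    using nz uD_tD(1) by (auto intro!: card_hexagon simp: cmul_def zero_prod_def)
  show "card (D a0 a1 a2 a3) = 24"
    unfolding D_eq by (simp add: card_Un_disjoint disj finite_hexagon card)
  show "(\<Sum>x\<in>D a0 a1 a2 a3. f x) = (\<Sum>x\<in>?A. f x) + (\<Sum>x\<in>?B. f x) + (\<Sum>x\<in>?C. f x) + (\<Sum>x\<in>?E. f x)"
    unfolding D_eq by (simp add: sum.union_disjoint disj finite_hexagon)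
  show "D a0 a1 a2 a3 \<subseteq> sphere 0 1"
  proof -
    have "norm (1 :: complex, 0 :: complex) = 1" by (simp add: norm_prod_def)
    moreover have "norm (uD * \<i>, tD * \<i> * w) = 1" if "cmod w = 1" for w
      using that uD_tD(3,4) by (simp add: norm_prod_def norm_mult)
    from this[of 1] this[of rD] this[of "cnj rD"] have "norm (uD * \<i>, tD * \<i>) = 1"
      "norm (uD * \<i>, tD * \<i> * rD) = 1" "norm (uD * \<i>, tD * \<i> * cnj rD) = 1"
      using rD_facts(4) by simp_all
    ultimately have "x \<in> D a0 a1 a2 a3 \<Longrightarrow> norm x = 1" for x
      unfolding D_eq hexagon_def using assms by (elim UnE imageE) (simp_all add: norm_cmul mu6_norm)
    then show ?thesis by (simp add: subset_iff del: split_paired_All)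
  qed
qed

text \<open>
  The factorial quotient is the Dirichlet integral for the mean of
  \<open>\<bar>z1\<bar>^(2 * a) * \<bar>z2\<bar>^(2 * c)\<close> over the unit sphere; it serves as the common value of the means
  over the \<open>24\<close> points and over the sphere.
\<close>
definition sphere_moment :: "nat \<Rightarrow> nat \<Rightarrow> nat \<Rightarrow> nat \<Rightarrow> complex" where
  "sphere_moment a b c d = (if a = b \<and> c = d then fact a * fact c / fact (a + c + 1) else 0)"

text \<open>
  Only \<open>a + c = b + d \<le> 2\<close> survives the hexagon sums, and there the unit factors
  \<open>a0, ..., a3\<close> cancel. What is left is a finite check: the sum of \<open>s ^ c * cnj s ^ d\<close> over
  the three cube roots of unity \<open>s\<close> vanishes for \<open>c \<noteq> d\<close> because \<open>\<bar>c - d\<bar> < 3\<close>, and for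
  \<open>c = d\<close> the values \<open>uD\<^sup>2 = 1/3\<close>, \<open>tD\<^sup>2 = 2/3\<close> give the moments.
\<close>
lemma sum_zmono_D:
  assumes "cmod a0 = 1" "cmod a1 = 1" "cmod a2 = 1" "cmod a3 = 1"
    and deg: "a + b + c + d \<le> 5"
  shows "(\<Sum>x\<in>D a0 a1 a2 a3. zmono a b c d x) = 24 * sphere_moment a b c d"
proof -
  have hex: "(\<Sum>x\<in>hexagon (cmul \<alpha> p). zmono a b c d x) =
      (if a + c = b + d then 6 * zmono a b c d p else 0)" if "cmod \<alpha> = 1" "p \<noteq> 0" for \<alpha> p
  proof -
    have "cmul \<alpha> p \<noteq> 0" using that norm_cmul[of \<alpha> p] by (metis mult_1 norm_eq_zero)
    with sum_hexagon[OF deg this] show ?thesis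
      using that(1) by (auto simp: zmono_scale unit_power_cnj)
  qed
  have ne: "(1, 0) \<noteq> (0 :: complex \<times> complex)" "(uD * \<i>, q) \<noteq> 0" for q
    using uD_tD(1) by (auto simp: zero_prod_def)
  show ?thesis
  proof (cases "a + c = b + d")
    case False
    then have "sphere_moment a b c d = 0" by (auto simp: sphere_moment_def)
    with False show ?thesis by (simp add: sum_D_hexagons hex ne assms)
  next
    case True
    define U where "U = complex_of_real uD"
    define T where "T = complex_of_real tD"
    have UT: "U * U = 1 / 3" "T * T = 2 / 3"
      using arg_cong[OF uD_tD(3), of complex_of_real] arg_cong[OF uD_tD(4), of complex_of_real]
      by (simp_all add: U_def T_def power2_eq_square)
    have cnj: "cnj U = U" "cnj T = T" by (simp_all add: U_def T_def)
    have S: "(\<Sum>x\<in>D a0 a1 a2 a3. zmono a b c d x) = 6 * (0 ^ c * 0 ^ d +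
       U ^ a * U ^ b * T ^ c * T ^ d * (\<i> ^ (a + c) * (- \<i>) ^ (b + d)) *
        (1 + rD ^ c * cnj rD ^ d + cnj rD ^ c * rD ^ d))"
      unfolding sum_D_hexagons[OF assms(1-4)] hex[OF assms(1) ne(1)] hex[OF assms(2) ne(2)]
        hex[OF assms(3) ne(2)] hex[OF assms(4) ne(2)] if_P[OF True]
      by (simp only: zmono_def fst_conv snd_conv complex_cnj_mult U_def[symmetric] T_def[symmetric] cnj
          complex_cnj_i complex_cnj_cnj complex_cnj_one complex_cnj_zero power_mult_distrib power_add
          power_one mult_1 mult_1_right distrib_left distrib_right mult_ac add_ac)
    have i: "\<i> ^ (a + c) * (- \<i>) ^ (b + d) = 1" using True unit_power_cnj[of \<i>] by simp
    have b: "b = a + c - d" and bnd: "a + c \<le> 2" "d \<le> a + c" using True deg by linarith+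
    \<comment> \<open>Everything is rewritten to linear polynomials in \<open>rD\<close>, so that equal values become
      syntactically equal.\<close>
    have r: "cnj rD = - 1 - rD" "rD * rD = - 1 - rD" "rD * (rD * x) = (- 1 - rD) * x" for x
      by (simp_all flip: mult.assoc) (simp_all add: rD_eq complex_eq_iff)
    have "(a, c) \<in> {(0,0), (1,0), (2,0), (0,1), (1,1), (0,2)}" "d \<in> {0, 1, 2}"
      using bnd by auto
    then show ?thesis unfolding S i unfolding b using bnd(2)
      by (auto simp: sphere_moment_def power2_eq_square UT r fact_numeral field_simps)
  qed
qed

section \<open>The moments of the sphere\<close>

lemma sphere_integral_orthogonal:
  fixes f :: "complex \<times> complex \<Rightarrow> complex" and T :: "complex \<times> complex \<Rightarrow> complex \<times> complex"
  assumes T: "orthogonal_transformation T" and f: "f \<in> borel_measurable borel"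
  shows "(\<integral>x. f (T x) \<partial>sphere_measure) = (\<integral>x. f x \<partial>sphere_measure)"
proof -
  have "T \<in> borel_measurable borel"
    using orthogonal_transformation_linear[OF T]
    by (auto intro!: borel_measurable_continuous_onI linear_continuous_on simp: linear_conv_bounded_linear)
  then have "T \<in> measurable sphere_measure borel" by (simp add: sphere_measure_def)
  from integral_distr[OF this f] show ?thesis
    by (simp only: sphere_measure_orthogonal_invariant[OF T])
qed

lemma zmono_measurable: "zmono a b c d \<in> borel_measurable borel"
  unfolding zmono_def[abs_def] by (intro borel_measurable_continuous_onI continuous_intros)

lemma zmono_integrable: "integrable sphere_measure (zmono a b c d)"
proof -
  interpret prob_space "sphere_measure :: (complex \<times> complex) measure"
    by (rule prob_space_sphere_measure)
  show ?thesis
  proof (rule integrable_const_bound[where B = 1])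
    show "AE x in sphere_measure. norm (zmono a b c d x) \<le> 1"
      using AE_sphere_measure
    proof eventually_elim
      case (elim x)
      then have "cmod (fst x) \<le> 1" "cmod (snd x) \<le> 1"
        using norm_fst_le[of "fst x" "snd x"] norm_snd_le[of "snd x" "fst x"] by simp_all
      then show ?case
        by (simp add: zmono_def norm_mult norm_power mult_le_one power_le_one)
    qed
    show "zmono a b c d \<in> borel_measurable sphere_measure"
      using zmono_measurable by (simp add: sphere_measure_def)
  qed
qed

lemma cpoly_integrable: "cpoly n f \<Longrightarrow> integrable sphere_measure f"
  by (induction rule: cpoly.induct) (auto simp: zmono_integrable)

lemma orthogonal_torus:
  assumes "cmod z = 1" "cmod w = 1"
  shows "orthogonal_transformation (\<lambda>p. (z * fst p, w * snd p))"
  unfolding orthogonal_transformation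
proof
  show "linear (\<lambda>p. (z * fst p, w * snd p))"
    by (rule linearI) (simp_all add: algebra_simps)
qed (simp add: assms norm_prod_def norm_mult)

lemma orthogonal_rotation:
  "orthogonal_transformation (\<lambda>p :: complex \<times> complex. (sqrt (1/2) * (fst p + snd p), sqrt (1/2) * (fst p - snd p)))"
  unfolding orthogonal_transformation
proof
  show "linear (\<lambda>p :: complex \<times> complex. (sqrt (1/2) * (fst p + snd p), sqrt (1/2) * (fst p - snd p)))"
    by (rule linearI) (simp_all add: algebra_simps)
  have "(cmod (x + y))\<^sup>2 / 2 + (cmod (x - y))\<^sup>2 / 2 = (cmod x)\<^sup>2 + (cmod y)\<^sup>2" for x y
    by (simp only: cmod_power2) (simp add: power2_eq_square field_simps)
  then show "\<forall>v :: complex \<times> complex. norm (sqrt (1/2) * (fst v + snd v), sqrt (1/2) * (fst v - snd v)) = norm v"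
    by (simp add: norm_prod_def norm_mult norm_divide power_mult_distrib power_divide real_sqrt_divide)
qed

lemma integral_zmono_torus:
  assumes "cmod z = 1" "cmod w = 1"
  shows "(\<integral>x. zmono a b c d x \<partial>sphere_measure) =
    z ^ a * cnj z ^ b * (w ^ c * cnj w ^ d) * (\<integral>x. zmono a b c d x \<partial>sphere_measure)"
proof -
  have "zmono a b c d (z * fst x, w * snd x) = z ^ a * cnj z ^ b * (w ^ c * cnj w ^ d) * zmono a b c d x" for x
    by (simp add: zmono_def power_mult_distrib mult_ac)
  then show ?thesis
    using sphere_integral_orthogonal[OF orthogonal_torus[OF assms] zmono_measurable[of a b c d]]
    by simp
qed

text \<open>
  A torus element whose character on the monomial is not \<open>1\<close> multiplies the integral by a factor
  different from \<open>1\<close> without changing it.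
\<close>
lemma integral_zmono_eq_0:
  assumes "a + b + c + d \<le> 5" "\<not> (a = b \<and> c = d)"
  shows "(\<integral>x. zmono a b c d x \<partial>sphere_measure) = 0"
proof (cases "a = b")
  case False
  then obtain z where "z \<in> mu6" "z ^ a * cnj z ^ b \<noteq> 1"
    using ex_separating_root[of a b] assms(1) by auto
  with integral_zmono_torus[of z 1 a b c d] show ?thesis by (simp add: mu6_norm)
next
  case True
  then obtain z where "z \<in> mu6" "z ^ c * cnj z ^ d \<noteq> 1"
    using ex_separating_root[of c d] assms by auto
  with integral_zmono_torus[of 1 z a b c d] show ?thesis by (simp add: mu6_norm)
qed

lemma orthogonal_swap: "orthogonal_transformation (prod.swap :: complex \<times> complex \<Rightarrow> _)"
  unfolding orthogonal_transformation
proof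
  show "linear (prod.swap :: complex \<times> complex \<Rightarrow> _)"
    by (rule linearI) (simp_all add: prod_eq_iff)
qed (simp add: norm_prod_def add.commute)

lemma integral_zmono_swap:
  "(\<integral>x. zmono a b c d x \<partial>sphere_measure) = (\<integral>x. zmono c d a b x \<partial>sphere_measure)"
proof -
  have "zmono a b c d (prod.swap x) = zmono c d a b x" for x
    by (simp add: zmono_def)
  then show ?thesis
    using sphere_integral_orthogonal[OF orthogonal_swap zmono_measurable[of a b c d]] by simp
qed

text \<open>
  Multiplication by \<open>\<bar>z1\<bar>\<^sup>2 + \<bar>z2\<bar>\<^sup>2\<close>, which equals \<open>1\<close> on the sphere, links the moments
  of different degrees.
\<close>
lemma integral_zmono_sphere:
  "(\<integral>x. zmono a b c d x \<partial>sphere_measure) =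
   (\<integral>x. zmono (Suc a) (Suc b) c d x \<partial>sphere_measure) + (\<integral>x. zmono a b (Suc c) (Suc d) x \<partial>sphere_measure)"
proof -
  have "(\<integral>x. zmono a b c d x \<partial>sphere_measure) =
    (\<integral>x. zmono (Suc a) (Suc b) c d x + zmono a b (Suc c) (Suc d) x \<partial>sphere_measure)"
  proof (rule integral_cong_AE)
    show "AE x in sphere_measure. zmono a b c d x = zmono (Suc a) (Suc b) c d x + zmono a b (Suc c) (Suc d) x"
      using AE_sphere_measure
    proof eventually_elim
      case (elim x)
      then have "(cmod (fst x))\<^sup>2 + (cmod (snd x))\<^sup>2 = 1"
        by (simp add: norm_prod_def)
      then have "fst x * cnj (fst x) + snd x * cnj (snd x) = 1"
        by (simp only: complex_norm_square[symmetric] of_real_add[symmetric] of_real_1)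
      then have "zmono a b c d x = zmono a b c d x * (fst x * cnj (fst x) + snd x * cnj (snd x))"
        by simp
      then show ?case by (simp add: zmono_def algebra_simps)
    qed
  qed (auto intro!: borel_measurable_add simp: zmono_measurable sphere_measure_def)
  then show ?thesis by (simp add: zmono_integrable)
qed

text \<open>
  Torus, swap and the relation on the sphere leave one moment of degree \<open>4\<close> undetermined. A
  rotation that mixes the coordinates determines it: it turns \<open>\<bar>z1\<bar>\<^sup>2 * \<bar>z2\<bar>\<^sup>2\<close> into
  \<open>\<bar>z1\<^sup>2 - z2\<^sup>2\<bar>\<^sup>2 / 4\<close>, whose cross terms integrate to \<open>0\<close>.
\<close>
lemma integral_zmono_rotation:
  "2 * (\<integral>x. zmono 1 1 1 1 x \<partial>sphere_measure) = (\<integral>x. zmono 2 2 0 0 x \<partial>sphere_measure)"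
proof -
  let ?R = "\<lambda>p :: complex \<times> complex. (sqrt (1/2) * (fst p + snd p), sqrt (1/2) * (fst p - snd p))"
  let ?I = "\<lambda>a b c d. (\<integral>x. zmono a b c d x \<partial>sphere_measure)"
  have s2: "complex_of_real (sqrt (1/2)) * complex_of_real (sqrt (1/2)) = 1/2"
    by (simp only: of_real_mult[symmetric] real_sqrt_mult_self) simp
  have rot: "zmono 1 1 1 1 (?R x) = 1/4 * (zmono 2 2 0 0 x + zmono 0 0 2 2 x - zmono 2 0 0 2 x - zmono 0 2 2 0 x)" for x
  proof -
    have "zmono 1 1 1 1 (?R x) =
        (complex_of_real (sqrt (1/2)) * complex_of_real (sqrt (1/2))) *
        (complex_of_real (sqrt (1/2)) * complex_of_real (sqrt (1/2))) *
        ((fst x + snd x) * cnj (fst x + snd x) * (fst x - snd x) * cnj (fst x - snd x))"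
      by (simp only: zmono_def fst_conv snd_conv power_one_right complex_cnj_mult
          complex_cnj_complex_of_real mult_ac)
    then show ?thesis unfolding s2
      by (simp add: zmono_def power2_eq_square algebra_simps)
  qed
  have "?I 1 1 1 1 = (\<integral>x. zmono 1 1 1 1 (?R x) \<partial>sphere_measure)"
    by (rule sphere_integral_orthogonal[OF orthogonal_rotation zmono_measurable, symmetric])
  also have "\<dots> = (\<integral>x. 1/4 * (zmono 2 2 0 0 x + zmono 0 0 2 2 x - zmono 2 0 0 2 x - zmono 0 2 2 0 x) \<partial>sphere_measure)"
    by (simp only: rot)
  also have "\<dots> = 1/4 * (?I 2 2 0 0 + ?I 0 0 2 2 - ?I 2 0 0 2 - ?I 0 2 2 0)"
    by (simp only: integral_mult_right_zero Bochner_Integration.integral_add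
        Bochner_Integration.integral_diff zmono_integrable Bochner_Integration.integrable_add Bochner_Integration.integrable_diff)
  also have "\<dots> = 1/4 * (2 * ?I 2 2 0 0)"
    using integral_zmono_eq_0[of 2 0 0 2] integral_zmono_eq_0[of 0 2 2 0] integral_zmono_swap[of 0 0 2 2] by simp
  finally show ?thesis by (simp add: mult.commute)
qed

lemma integral_zmono:
  assumes deg: "a + b + c + d \<le> 5"
  shows "(\<integral>x. zmono a b c d x \<partial>sphere_measure) = sphere_moment a b c d"
proof (cases "a = b \<and> c = d")
  case False
  then have "sphere_moment a b c d = 0" unfolding sphere_moment_def by (rule if_not_P)
  then show ?thesis using integral_zmono_eq_0[OF deg False] by simp
next
  case True
  let ?I = "\<lambda>a c. (\<integral>x. zmono a a c c x \<partial>sphere_measure)"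
  interpret prob_space "sphere_measure :: (complex \<times> complex) measure"
    by (rule prob_space_sphere_measure)
  have solve: "x = 1/2 \<and> y = 1/3 \<and> z = 1/6" if "1 = x + x" "x = y + z" "2 * z = y" for x y z :: complex
  proof -
    have y: "y = 2 * z" using that(3) by (rule sym)
    have x: "x = 3 * z" using that(2) y by simp
    have "z = (x + x) / 6" by (simp add: x)
    then have z: "z = 1/6" by (simp only: that(1)[symmetric])
    show ?thesis unfolding x y z by simp
  qed
  have "?I 0 0 = 1" by (simp add: zmono_def prob_space)
  moreover have "?I 0 1 = ?I 1 0" "?I 0 2 = ?I 2 0"
    by (rule integral_zmono_swap)+
  moreover have "?I 0 0 = ?I 1 0 + ?I 0 1" "?I 1 0 = ?I 2 0 + ?I 1 1"
    using integral_zmono_sphere[of 0 0 0 0] integral_zmono_sphere[of 1 1 0 0] by (simp_all add: numeral_2_eq_2)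
  moreover have "2 * ?I 1 1 = ?I 2 0" by (rule integral_zmono_rotation)
  ultimately have I: "?I 0 0 = 1" "?I 1 0 = 1/2" "?I 0 1 = 1/2" "?I 2 0 = 1/3" "?I 0 2 = 1/3" "?I 1 1 = 1/6"
    using solve[of "?I 1 0" "?I 2 0" "?I 1 1"] by simp_all
  have "(a, c) \<in> {(0,0), (1,0), (2,0), (0,1), (1,1), (0,2)}" using True deg by auto
  then show ?thesis using True I by (auto simp: sphere_moment_def fact_numeral)
qed

section \<open>The design property\<close>

lemma D_design:
  assumes "cmod a0 = 1" "cmod a1 = 1" "cmod a2 = 1" "cmod a3 = 1"
  shows "spherical_design 5 (D a0 a1 a2 a3)"
  unfolding spherical_design_def
proof (intro conjI allI impI)
  show "finite (D a0 a1 a2 a3)" by (simp add: D_eq finite_hexagon)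
  show "D a0 a1 a2 a3 \<subseteq> sphere 0 1" by (rule D_subset_sphere[OF assms])
  fix P :: "complex \<times> complex \<Rightarrow> real" assume "polynomial_deg_le 5 P"
  then have P: "cpoly 5 (\<lambda>x. of_real (P x))" by (rule cpoly_of_polynomial_deg_le)
  have "(\<Sum>x\<in>D a0 a1 a2 a3. f x) = 24 * (\<integral>x. f x \<partial>sphere_measure)" if "cpoly 5 f" for f
    using that
  proof induction
    case (mono a b c d)
    then show ?case by (simp only: sum_zmono_D[OF assms] integral_zmono)
  next
    case (add f g)
    then show ?case by (simp add: sum.distrib cpoly_integrable algebra_simps)
  next
    case (scale f s)
    then show ?case by (simp flip: sum_distrib_left)
  qed
  from this[OF P] have "complex_of_real (\<Sum>x\<in>D a0 a1 a2 a3. P x) = of_real (24 * (\<integral>x. P x \<partial>sphere_measure))"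
    by simp
  then show "(\<Sum>x\<in>D a0 a1 a2 a3. P x) / real (card (D a0 a1 a2 a3)) = (\<integral>x. P x \<partial>sphere_measure)"
    unfolding of_real_eq_iff card_D[OF assms] by simp
qed

section \<open>Congruences\<close>

lemma cmul_hexagon: "cmul w ` hexagon p = hexagon (cmul w p)"
  by (simp add: hexagon_def image_image cmul_def mult.left_commute)

lemma D_scale: "cmul w ` D a0 a1 a2 a3 = D (w * a0) (w * a1) (w * a2) (w * a3)"
  unfolding D_eq image_Un cmul_hexagon by (simp add: cmul_def mult.assoc)

lemma orthogonal_cmul: "cmod w = 1 \<Longrightarrow> orthogonal_transformation (cmul w)"
  using orthogonal_torus[of w w] by (simp add: cmul_def[abs_def])

lemma D_scale_congruent:
  assumes "cmod w = 1"
  shows "D a0 a1 a2 a3 \<cong>\<^sub>O D (w * a0) (w * a1) (w * a2) (w * a3)"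
  unfolding congruent_sets_def using orthogonal_cmul[OF assms] D_scale by blast

lemma finite_unit_circle_Im: "finite {b. cmod b = 1 \<and> Im b = y}"
proof (rule finite_subset)
  show "{b. cmod b = 1 \<and> Im b = y} \<subseteq> {Complex (sqrt (1 - y\<^sup>2)) y, Complex (- sqrt (1 - y\<^sup>2)) y}"
  proof
    fix b assume b: "b \<in> {b. cmod b = 1 \<and> Im b = y}"
    then have "(Re b)\<^sup>2 = 1 - y\<^sup>2"
      by (auto simp: cmod_def)
    then have "\<bar>Re b\<bar> = sqrt (1 - y\<^sup>2)"
      by (metis real_sqrt_abs)
    with b show "b \<in> {Complex (sqrt (1 - y\<^sup>2)) y, Complex (- sqrt (1 - y\<^sup>2)) y}"
      by (auto simp: complex_eq_iff abs_if split: if_splits)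
  qed
qed simp

text \<open>
  \<open>S\<close> depends on the fixed set only, and by congruence it contains every inner product of two
  points of the other set; \<open>B\<close> collects the parameters that this leaves possible.
\<close>
lemma finite_congruent_parameters:
  "finite {(b1, b2, b3). cmod b1 = 1 \<and> cmod b2 = 1 \<and> cmod b3 = 1 \<and>
                        D 1 a1 a2 a3 \<cong>\<^sub>O D 1 b1 b2 b3}" (is "finite ?T")
proof -
  let ?D = "D 1 a1 a2 a3"
  define S where "S = (\<lambda>(x, y). x \<bullet> y) ` (?D \<times> ?D)"
  define B where "B = {b. cmod b = 1 \<and> - uD * Im b \<in> S}"
  have "finite S" by (simp add: S_def D_eq finite_hexagon)
  have "B \<subseteq> (\<Union>s\<in>S. {b. cmod b = 1 \<and> Im b = - s / uD})"
    using uD_tD(1) by (auto simp: B_def)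
  then have "finite B"
    by (rule finite_subset) (simp add: \<open>finite S\<close> finite_unit_circle_Im)
  have "?T \<subseteq> B \<times> B \<times> B"
  proof
    fix x assume "x \<in> ?T"
    then obtain b1 b2 b3 where x: "x = (b1, b2, b3)"
      and n: "cmod b1 = 1" "cmod b2 = 1" "cmod b3 = 1" and "?D \<cong>\<^sub>O D 1 b1 b2 b3"
      by auto
    then obtain f where f: "orthogonal_transformation f" "f ` ?D = D 1 b1 b2 b3"
      unfolding congruent_sets_def by blast
    have S: "x \<bullet> y \<in> S" if "x \<in> D 1 b1 b2 b3" "y \<in> D 1 b1 b2 b3" for x y
    proof -
      from that obtain x' y' where xy: "x' \<in> ?D" "y' \<in> ?D" "x = f x'" "y = f y'"
        unfolding f(2)[symmetric] by (elim imageE)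
      moreover have "f x' \<bullet> f y' = x' \<bullet> y'"
        using f(1) unfolding orthogonal_transformation_def by blast
      ultimately show ?thesis
        unfolding S_def by (intro image_eqI[of _ _ "(x', y')"]) simp_all
    qed
    have self: "p \<in> hexagon p" for p
      unfolding hexagon_def by (rule image_eqI[of _ _ 1]) (auto simp: cmul_def mu6_def)
    have "(1, 0) \<in> D 1 b1 b2 b3"
      using self[of "cmul 1 (1, 0)"] unfolding D_eq by (simp add: cmul_def)
    moreover have "cmul b1 (uD * \<i>, tD * \<i>) \<in> D 1 b1 b2 b3"
      "cmul b2 (uD * \<i>, tD * \<i> * rD) \<in> D 1 b1 b2 b3"
      "cmul b3 (uD * \<i>, tD * \<i> * cnj rD) \<in> D 1 b1 b2 b3"
      using self unfolding D_eq by blast+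
    moreover have "(1, 0) \<bullet> cmul b (uD * \<i>, q) = - uD * Im b" for b q
      by (simp add: cmul_def inner_prod_def inner_complex_def)
    ultimately have "- uD * Im b1 \<in> S" "- uD * Im b2 \<in> S" "- uD * Im b3 \<in> S"
      using S by metis+
    with n show "x \<in> B \<times> B \<times> B" by (simp add: x B_def)
  qed
  then show ?thesis
    by (rule finite_subset) (simp add: \<open>finite B\<close>)
qed

theorem mainTheorem3:
  shows "(\<forall>a0 a1 a2 a3 :: complex.
            cmod a0 = 1 \<and> cmod a1 = 1 \<and> cmod a2 = 1 \<and> cmod a3 = 1 \<longrightarrow>
              D a0 a1 a2 a3 \<subseteq> sphere 0 1 \<and>
              card (D a0 a1 a2 a3) = 24 \<and>
              spherical_design 5 (D a0 a1 a2 a3))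
       \<and> (\<forall>\<alpha> a0 a1 a2 a3 :: complex.
            cmod \<alpha> = 1 \<and> cmod a0 = 1 \<and> cmod a1 = 1 \<and> cmod a2 = 1 \<and> cmod a3 = 1 \<longrightarrow>
              D (\<alpha> * a0) (\<alpha> * a1) (\<alpha> * a2) (\<alpha> * a3) \<cong>\<^sub>O D a0 a1 a2 a3)
       \<and> (\<forall>a0 a1 a2 a3 :: complex.
            cmod a0 = 1 \<and> cmod a1 = 1 \<and> cmod a2 = 1 \<and> cmod a3 = 1 \<longrightarrow>
              (\<exists>b1 b2 b3. cmod b1 = 1 \<and> cmod b2 = 1 \<and> cmod b3 = 1 \<and>
                 D a0 a1 a2 a3 \<cong>\<^sub>O D 1 b1 b2 b3))
       \<and> (\<forall>a1 a2 a3 :: complex.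
            cmod a1 = 1 \<and> cmod a2 = 1 \<and> cmod a3 = 1 \<longrightarrow>
              finite {(b1, b2, b3). cmod b1 = 1 \<and> cmod b2 = 1 \<and> cmod b3 = 1 \<and>
                        D 1 a1 a2 a3 \<cong>\<^sub>O D 1 b1 b2 b3})"
proof (intro conjI allI impI; (elim conjE)?)
  fix a0 a1 a2 a3 :: complex
  assume a: "cmod a0 = 1" "cmod a1 = 1" "cmod a2 = 1" "cmod a3 = 1"
  show "D a0 a1 a2 a3 \<subseteq> sphere 0 1" "card (D a0 a1 a2 a3) = 24"
    by (rule D_subset_sphere[OF a], rule card_D[OF a])
  show "spherical_design 5 (D a0 a1 a2 a3)" by (rule D_design[OF a])
  have "D a0 a1 a2 a3 \<cong>\<^sub>O D 1 (cnj a0 * a1) (cnj a0 * a2) (cnj a0 * a3)"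
    using D_scale_congruent[of "cnj a0" a0 a1 a2 a3] unit_power_cnj[of a0 1] a(1)
    by (simp add: mult.commute)
  then show "\<exists>b1 b2 b3. cmod b1 = 1 \<and> cmod b2 = 1 \<and> cmod b3 = 1 \<and> D a0 a1 a2 a3 \<cong>\<^sub>O D 1 b1 b2 b3"
    using a by (intro exI conjI) (simp_all add: norm_mult)
next
  fix \<alpha> a0 a1 a2 a3 :: complex
  assume \<alpha>: "cmod \<alpha> = 1"
  have "cnj \<alpha> * (\<alpha> * b) = b" for b
    using unit_power_cnj[OF \<alpha>, of 1] by (simp add: mult.commute flip: mult.assoc)
  then show "D (\<alpha> * a0) (\<alpha> * a1) (\<alpha> * a2) (\<alpha> * a3) \<cong>\<^sub>O D a0 a1 a2 a3"
    using D_scale_congruent[of "cnj \<alpha>" "\<alpha> * a0" "\<alpha> * a1" "\<alpha> * a2" "\<alpha> * a3"] \<alpha>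
    by (simp only: complex_mod_cnj)
qed (rule finite_congruent_parameters)

end
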